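(* Let $k_1,k_2,k_3\in\mathbb{Z}_{\ge0}$ and let $(P,Q,R)$ be a $(k_1,k_2,k_3)$-CGC triple associated with the non-labeled cluster $(a,b,c)$. Then: (1) the $(1,2)$-entry of $PQ-S_R$ is $\frac{a^2+k_cab+b^2}{c}$ and the $(1,2)$-entry of $QR-S_P$ is $\frac{b^2+k_abc+c^2}{a}$; (2) $\mathrm{tr}(PQ-S_R)=\mathscr{M}m_{12}-k_c$ and $\mathrm{tr}(QR-S_P)=\mathscr{M}n_{12}-k_a$, where $m_{12}$ and $n_{12}$ denote the $(1,2)$-entries of $PQ-S_R$ and $QR-S_P$ respectively; (3) $PQ-S_R,\ QR-S_P\in SL(2,\mathbb{Z}[x_1^{\pm1},x_2^{\pm1},x_3^{\pm1}])$. In particular, $(P,PQ-S_R,Q)$ and $(Q,QR-S_P,R)$ are $(k_1,k_2,k_3)$-CGC triples.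
   Context: Fix $k_1,k_2,k_3\in\mathbb{Z}_{\ge0}$ and indeterminates $x_1,x_2,x_3$. Mutations of triples of nonzero rational functions: $\mu_1(a,b,c)=(\frac{b^2+k_1bc+c^2}{a},b,c)$, $\mu_2(a,b,c)=(a,\frac{a^2+k_2ac+c^2}{b},c)$, $\mu_3(a,b,c)=(a,b,\frac{a^2+k_3ab+b^2}{c})$. A labeled cluster of $\mathcal{A}(k_1,k_2,k_3)$ is a triple obtained from $(x_1,x_2,x_3)$ by finitely many mutations; a non-labeled cluster is any permutation of a labeled cluster; a cluster variable is an entry of a labeled cluster. Each cluster variable $y$ occurs in only one position $i$ among labeled clusters; its parity is $k_y:=k_i$. Let $\mathscr{M}=\frac{x_1^2+x_2^2+x_3^2+k_1x_2x_3+k_2x_1x_3+k_3x_1x_2}{x_1x_2x_3}$. For a $2\times2$ matrix $P=(p_{ij})$ over $\mathbb{Z}[x_1^{\pm1},x_2^{\pm1},x_3^{\pm1}]$ set $S_P=\begin{bmatrix}\mathscr{M}p_{12}-\mathrm{tr}P&0\\(\mathscr{M}p_{12}-\mathrm{tr}P)\mathscr{M}&\mathscr{M}p_{12}-\mathrm{tr}P\end{bmatrix}$. A $(k_1,k_2,k_3)$-CGC matrix is a $P\in SL(2,\mathbb{Z}[x_1^{\pm1},x_2^{\pm1},x_3^{\pm1}])$ whose $(1,2)$-entry $p_{12}$ is a cluster variable and with $\mathrm{tr}(P)=\mathscr{M}p_{12}-k_{p_{12}}$. A $(k_1,k_2,k_3)$-CGC triple is a triple $(P,Q,R)$ of CGC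 matrices with $Q=PR-S_Q$ such that $(p_{12},q_{12},r_{12})$ (the $(1,2)$-entries) is a non-labeled cluster; it is said to be associated with $(p_{12},q_{12},r_{12})$. *)

theory Defs
  imports
    "HOL-Analysis.Determinants"
    "HOL-Computational_Algebra.Polynomial_Factorial"
    "HOL-Library.Multiset"
begin

text \<open>
  The field of rational functions in three indeterminates is the fraction field of the iterated
  polynomial ring \<open>\<int>[x\<^sub>1][x\<^sub>2][x\<^sub>3]\<close>; the innermost polynomial variable is \<open>x\<^sub>1\<close>, the outermost
  one is \<open>x\<^sub>3\<close>.
\<close>

type_synonym ratfun = "int poly poly poly fract"

definition x1 :: ratfun where "x1 = to_fract [:[:[:0, 1:]:]:]"
definition x2 :: ratfun where "x2 = to_fract [:[:0, 1:]:]"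
definition x3 :: ratfun where "x3 = to_fract [:0, 1:]"

definition laurent_ring :: "ratfun set" where
  "laurent_ring = {to_fract p / (x1 ^ i * x2 ^ j * x3 ^ l) | p i j l. True}"

text \<open>
  Clusters, and also the parameter \<open>(k\<^sub>1, k\<^sub>2, k\<^sub>3)\<close>, are triples. Position \<open>i \<in> {1, 2, 3}\<close> of a
  triple \<open>t\<close> is \<open>entries t ! (i - 1)\<close>, i.e. positions are counted from \<open>0\<close> below.
\<close>

type_synonym params = "nat \<times> nat \<times> nat"
type_synonym cluster = "ratfun \<times> ratfun \<times> ratfun"

fun entries :: "'a \<times> 'a \<times> 'a \<Rightarrow> 'a list" where
  "entries (a, b, c) = [a, b, c]"

fun mutation1 :: "params \<Rightarrow> cluster \<Rightarrow> cluster" where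
  "mutation1 (k1, k2, k3) (a, b, c) = ((b\<^sup>2 + of_nat k1 * b * c + c\<^sup>2) / a, b, c)"

fun mutation2 :: "params \<Rightarrow> cluster \<Rightarrow> cluster" where
  "mutation2 (k1, k2, k3) (a, b, c) = (a, (a\<^sup>2 + of_nat k2 * a * c + c\<^sup>2) / b, c)"

fun mutation3 :: "params \<Rightarrow> cluster \<Rightarrow> cluster" where
  "mutation3 (k1, k2, k3) (a, b, c) = (a, b, (a\<^sup>2 + of_nat k3 * a * b + b\<^sup>2) / c)"

inductive_set labeled_clusters :: "params \<Rightarrow> cluster set" for k :: params where
  initial: "(x1, x2, x3) \<in> labeled_clusters k"
| mut1: "t \<in> labeled_clusters k \<Longrightarrow> mutation1 k t \<in> labeled_clusters k"
| mut2: "t \<in> labeled_clusters k \<Longrightarrow> mutation2 k t \<in> labeled_clusters k"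
| mut3: "t \<in> labeled_clusters k \<Longrightarrow> mutation3 k t \<in> labeled_clusters k"

definition nonlabeled_clusters :: "params \<Rightarrow> cluster set" where
  "nonlabeled_clusters k =
     {t. \<exists>u \<in> labeled_clusters k. mset (entries t) = mset (entries u)}"

definition cluster_variables :: "params \<Rightarrow> ratfun set" where
  "cluster_variables k = (\<Union>t \<in> labeled_clusters k. set (entries t))"

text \<open>
  The parity \<open>k\<^sub>y\<close> of a cluster variable \<open>y\<close>. The definite description relies on the fact that \<open>y\<close>
  occurs in only one position among all labeled clusters.
\<close>

definition parity :: "params \<Rightarrow> ratfun \<Rightarrow> nat" where
  "parity k y = entries k ! (THE i. i < 3 \<and> (\<exists>t \<in> labeled_clusters k. entries t ! i = y))"

fun markov_const :: "params \<Rightarrow> ratfun" where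
  "markov_const (k1, k2, k3) =
     (x1\<^sup>2 + x2\<^sup>2 + x3\<^sup>2 + of_nat k1 * x2 * x3 + of_nat k2 * x1 * x3 + of_nat k3 * x1 * x2)
       / (x1 * x2 * x3)"

type_synonym mat2 = "ratfun ^ 2 ^ 2"

definition S_mat :: "params \<Rightarrow> mat2 \<Rightarrow> mat2" where
  "S_mat k P =
     (let M = markov_const k; s = M * P $ 1 $ 2 - trace P
      in vector [vector [s, 0], vector [s * M, s]])"

definition SL2_laurent :: "mat2 set" where
  "SL2_laurent = {P. (\<forall>i j. P $ i $ j \<in> laurent_ring) \<and> det P = 1}"

definition cgc_matrix :: "params \<Rightarrow> mat2 \<Rightarrow> bool" where
  "cgc_matrix k P \<longleftrightarrow>
     P \<in> SL2_laurent \<and>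
     P $ 1 $ 2 \<in> cluster_variables k \<and>
     trace P = markov_const k * P $ 1 $ 2 - of_nat (parity k (P $ 1 $ 2))"

fun associated_cluster :: "mat2 \<times> mat2 \<times> mat2 \<Rightarrow> cluster" where
  "associated_cluster (P, Q, R) = (P $ 1 $ 2, Q $ 1 $ 2, R $ 1 $ 2)"

fun cgc_triple :: "params \<Rightarrow> mat2 \<times> mat2 \<times> mat2 \<Rightarrow> bool" where
  "cgc_triple k (P, Q, R) \<longleftrightarrow>
     cgc_matrix k P \<and> cgc_matrix k Q \<and> cgc_matrix k R \<and>
     Q = P ** R - S_mat k Q \<and>
     associated_cluster (P, Q, R) \<in> nonlabeled_clusters k"

end

theory Submission
  imports Defs
begin

text \<open>
  The lexicographic order on \<open>\<int>[x\<^sub>1][x\<^sub>2][x\<^sub>3]\<close> makes the field of rational functions an ordered field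
  in which all cluster variables are positive. Up to Archimedean comparability,
  \<open>b\<^sup>2 + k b c + c\<^sup>2\<close> is the square of \<open>max b c\<close>, so a mutation changes the mutated entry only by a
  comparable factor and a square. Hence every variable in position \<open>i\<close> is comparable to a square times
  \<open>x\<^sub>i\<close>; comparing the parities of the degrees shows that the three classes are distinct, which
  makes the parity of a cluster variable well defined.

  The trace condition turns \<open>S\<^sub>P\<close> into the constant matrix \<open>k L\<close> with \<open>L = [1, 0; M, 1]\<close>. From
  \<open>P R = Q + k\<^sub>b L\<close> one expresses the diagonal entries of \<open>P\<close> and \<open>Q\<close> through those of \<open>R\<close>, and
  everything reduces to the Markov-type equation
  \<open>a\<^sup>2 + b\<^sup>2 + c\<^sup>2 + k\<^sub>a b c + k\<^sub>b a c + k\<^sub>c a b = M a b c\<close>. The statement about \<open>Q R - S\<^sub>P\<close>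
  follows from the one about \<open>P Q - S\<^sub>R\<close> because exchanging the two diagonal entries is an
  anti-automorphism of \<open>2 \<times> 2\<close> matrices that fixes \<open>L\<close> and all off-diagonal entries.
\<close>

section \<open>Archimedean comparability\<close>

text \<open>Archimedean equivalence of positive elements. It is phrased without division, so it
  applies to polynomials as well as to fractions.\<close>

definition comparable :: "'a::linordered_idom \<Rightarrow> 'a \<Rightarrow> bool" where
  "comparable y z \<longleftrightarrow> 0 < y \<and> 0 < z \<and> (\<exists>n::nat. y \<le> of_nat n * z \<and> z \<le> of_nat n * y)"

lemma comparable_pos: "comparable y z \<Longrightarrow> 0 < y" "comparable y z \<Longrightarrow> 0 < z"
  by (auto simp: comparable_def)

lemma comparableI:
  assumes "0 < y" "0 < z" "y \<le> of_nat m * z" "z \<le> of_nat n * y"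
  shows "comparable y z"
proof -
  have "y \<le> of_nat (max m n) * z" "z \<le> of_nat (max m n) * y"
    using assms by (meson order_trans mult_right_mono max.cobounded1 max.cobounded2
        of_nat_mono order_less_imp_le)+
  then show ?thesis
    using assms unfolding comparable_def by blast
qed

lemma comparable_refl: "0 < y \<Longrightarrow> comparable y y"
  by (rule comparableI[of _ _ 1 1]) auto

lemma comparable_sym: "comparable y z \<Longrightarrow> comparable z y"
  by (auto simp: comparable_def)

lemma comparable_mult:
  assumes "comparable y z" "comparable y' z'"
  shows "comparable (y * y') (z * z')"
proof -
  obtain n m :: nat where nm: "y \<le> of_nat n * z" "z \<le> of_nat n * y"
      "y' \<le> of_nat m * z'" "z' \<le> of_nat m * y'"
    using assms unfolding comparable_def by blast
  have pos: "0 < y" "0 < z" "0 < y'" "0 < z'"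
    using assms comparable_pos by blast+
  have "y * y' \<le> (of_nat n * z) * (of_nat m * z')" "z * z' \<le> (of_nat n * y) * (of_nat m * y')"
    using nm pos by (intro mult_mono; simp)+
  then show ?thesis
    using pos by (intro comparableI[of _ _ "n * m" "n * m"]) (simp_all add: mult_ac)
qed

lemma comparable_trans:
  assumes "comparable x y" "comparable y z"
  shows "comparable x z"
proof -
  obtain n m :: nat where nm: "x \<le> of_nat n * y" "y \<le> of_nat n * x"
      "y \<le> of_nat m * z" "z \<le> of_nat m * y"
    using assms unfolding comparable_def by blast
  have "of_nat n * y \<le> of_nat n * (of_nat m * z)" "of_nat m * y \<le> of_nat m * (of_nat n * x)"
    using nm by (intro mult_left_mono; simp)+
  then have "x \<le> of_nat (n * m) * z" "z \<le> of_nat (m * n) * x"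
    using nm by (simp_all add: mult_ac)
  then show ?thesis
    using assms comparable_pos by (blast intro: comparableI)
qed

text \<open>Positivity of a polynomial means positivity of its leading coefficient, so leading terms
  of non-negative summands never cancel, and a natural multiple cannot raise the degree.\<close>

lemma comparable_poly:
  fixes p q :: "'a::linordered_idom poly"
  assumes "comparable p q"
  shows "degree p = degree q" "comparable (lead_coeff p) (lead_coeff q)"
proof -
  have lead_le: "degree p \<le> degree q" "degree p = degree q \<longrightarrow> lead_coeff p \<le> of_nat n * lead_coeff q"
    if le: "p \<le> of_nat n * q" and pos: "0 < p" "0 < q" for p q :: "'a poly" and n :: nat
  proof -
    define r where "r = of_nat n * q - p"
    have r: "r = 0 \<or> pos_poly r" and p: "pos_poly p"
      using le pos by (auto simp: r_def less_eq_poly_def less_poly_def)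
    have rp: "p + r = smult (of_nat n) q"
      unfolding r_def by (simp add: of_nat_poly)
    \<comment> \<open>The multiple \<open>of_nat n * q\<close> is the sum of \<open>p > 0\<close>
      and \<open>r \<ge> 0\<close>, so the leading term of \<open>p\<close> cannot be
      cancelled.\<close>
    have *: "degree p \<le> degree (p + r)"
    proof (cases "degree r = degree p")
      case True
      have "coeff (p + r) (degree p) > 0"
        using True r p by (auto simp: pos_poly_def intro: add_pos_pos)
      then show ?thesis
        by (intro le_degree) auto
    next
      case False
      then show ?thesis
        by (metis degree_add_eq_left degree_add_eq_right nat_neq_iff order_less_imp_le order_refl)
    qed
    have "degree p \<le> degree (smult (of_nat n) q)"
      using * by (simp add: rp)
    also have "\<dots> \<le> degree q"
      by (rule degree_smult_le)
    finally show d: "degree p \<le> degree q" .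
    show "degree p = degree q \<longrightarrow> lead_coeff p \<le> of_nat n * lead_coeff q"
    proof
      assume eq: "degree p = degree q"
      \<comment> \<open>The coefficient of \<open>r\<close> at \<open>degree p\<close> is therefore
        its leading coefficient or 0, in both cases non-negative.\<close>
      have "degree r \<le> degree p"
        unfolding r_def eq of_nat_poly by (intro degree_diff_le) (simp_all add: eq)
      then have "0 \<le> coeff r (degree p)"
        using r unfolding pos_poly_def
        by (metis coeff_0 coeff_eq_0 le_neq_implies_less order_less_imp_le order_refl)
      then show "lead_coeff p \<le> of_nat n * lead_coeff q"
        by (simp add: r_def of_nat_poly eq)
    qed
  qed
  obtain n :: nat where n: "p \<le> of_nat n * q" "q \<le> of_nat n * p"
    using assms unfolding comparable_def by blast
  have pos: "0 < p" "0 < q"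
    using assms comparable_pos by blast+
  show d: "degree p = degree q"
    using lead_le n pos by (meson le_antisym)
  show "comparable (lead_coeff p) (lead_coeff q)"
    using lead_le(2)[OF n(1) pos] lead_le(2)[OF n(2) pos(2,1)] pos d
    by (intro comparableI[of _ _ n n]) (simp_all add: less_poly_def pos_poly_def)
qed

section \<open>Transfer of comparability from fractions to polynomials\<close>

lemma to_fract_le_iff [simp]: "to_fract p \<le> to_fract q \<longleftrightarrow> p \<le> q"
  by (simp add: to_fract_def)

lemma to_fract_less_iff [simp]: "to_fract p < to_fract q \<longleftrightarrow> p < q"
  by (simp add: to_fract_def)

lemma to_fract_of_nat [simp]: "to_fract (of_nat n) = of_nat n"
  by (induction n) simp_all

lemma to_fract_power [simp]: "to_fract (p ^ n) = to_fract p ^ n"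
  by (induction n) simp_all

lemma comparable_to_fractD:
  assumes "comparable (to_fract p) (to_fract q)"
  shows "comparable p q"
proof -
  obtain n :: nat where "to_fract p \<le> to_fract (of_nat n * q)" "to_fract q \<le> to_fract (of_nat n * p)"
    using assms unfolding comparable_def by auto
  moreover have "to_fract 0 < to_fract p" "to_fract 0 < to_fract q"
    using assms comparable_pos by simp_all
  ultimately show ?thesis
    unfolding to_fract_le_iff to_fract_less_iff by (blast intro: comparableI)
qed

text \<open>With \<open>m = max b c\<close>, one of the two squares is \<open>m^2\<close>, and the
  three terms are at most \<open>m^2\<close>, \<open>k * m^2\<close> and \<open>m^2\<close>; this
  gives the constants 1 and \<open>k + 2\<close>.\<close>

lemma comparable_quadratic_form:
  fixes b c :: "'a::linordered_idom"
  assumes "0 < b" "0 < c"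
  shows "comparable (b\<^sup>2 + of_nat k * b * c + c\<^sup>2) ((max b c)\<^sup>2)"
proof -
  define m where "m = max b c"
  have m: "0 < m" "b \<le> m" "c \<le> m" "m\<^sup>2 = b\<^sup>2 \<or> m\<^sup>2 = c\<^sup>2"
    using assms by (auto simp: m_def max_def)
  have sq: "b\<^sup>2 \<le> m\<^sup>2" "c\<^sup>2 \<le> m\<^sup>2"
    using m assms by (auto intro: power_mono)
  have "b * c \<le> m * m"
    using m assms by (intro mult_mono) auto
  then have prod: "of_nat k * b * c \<le> of_nat k * m\<^sup>2"
    by (simp add: mult.assoc power2_eq_square mult_left_mono)
  have nonneg: "0 \<le> of_nat k * b * c"
    using assms by simp
  have "0 < b\<^sup>2" "0 < c\<^sup>2"
    using assms by simp_all
  then have "0 < b\<^sup>2 + of_nat k * b * c + c\<^sup>2" "m\<^sup>2 \<le> b\<^sup>2 + of_nat k * b * c + c\<^sup>2"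
    using nonneg m(4) by linarith+
  moreover have "b\<^sup>2 + of_nat k * b * c + c\<^sup>2 \<le> of_nat (k + 2) * m\<^sup>2"
    using sq prod by (simp add: algebra_simps)
  ultimately show ?thesis
    using m(1) unfolding m_def[symmetric] by (intro comparableI[of _ _ "k + 2" 1]) auto
qed

text \<open>Equality in the group of Archimedean classes modulo squares.\<close>

definition same_square_class :: "'a::linordered_field \<Rightarrow> 'a \<Rightarrow> bool" where
  "same_square_class y x \<longleftrightarrow> (\<exists>w>0. comparable y (w\<^sup>2 * x))"

lemma same_square_class_refl: "0 < x \<Longrightarrow> same_square_class x x"
  unfolding same_square_class_def by (intro exI[of _ 1]) (simp add: comparable_refl)

lemma same_square_class_pos: "same_square_class y x \<Longrightarrow> 0 < y"
  by (auto simp: same_square_class_def dest: comparable_pos)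

text \<open>The numerator is comparable to a square and inversion preserves the class, since
  \<open>1 / x = (1 / x)^2 * x\<close>.\<close>

lemma same_square_class_exchange:
  fixes x y b c :: "'a::linordered_field"
  assumes "same_square_class y x" "0 < b" "0 < c"
  shows "same_square_class ((b\<^sup>2 + of_nat k * b * c + c\<^sup>2) / y) x"
proof -
  define s where "s = b\<^sup>2 + of_nat k * b * c + c\<^sup>2"
  define m where "m = max b c"
  obtain w where w: "0 < w" and yw: "comparable y (w\<^sup>2 * x)"
    using assms(1) unfolding same_square_class_def by blast
  have sm: "comparable s (m\<^sup>2)"
    using comparable_quadratic_form[OF assms(2,3)] by (simp add: s_def m_def)
  have pos: "0 < y" "0 < w\<^sup>2 * x" "0 < x" "0 < s" "0 < m"
    using comparable_pos[OF yw] comparable_pos[OF sm] w assms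
    by (auto simp: zero_less_mult_iff m_def)
  \<comment> \<open>Multiplication by \<open>v\<close> inverts the comparison of \<open>y\<close>
    with \<open>w^2 * x\<close>: the two sides become \<open>s / (w^2 * x)\<close> and
    \<open>s / y\<close>.\<close>
  define v where "v = s / (y * (w\<^sup>2 * x))"
  have "comparable (y * v) ((w\<^sup>2 * x) * v)"
    using pos w by (intro comparable_mult yw comparable_refl) (simp add: v_def)
  moreover have "comparable (s * inverse (w\<^sup>2 * x)) (m\<^sup>2 * inverse (w\<^sup>2 * x))"
    using pos by (intro comparable_mult sm comparable_refl) (simp only: inverse_positive_iff_positive)
  moreover have "(w\<^sup>2 * x) * v = s / y" "y * v = s * inverse (w\<^sup>2 * x)"
    using pos w by (simp_all add: v_def field_simps)
  moreover have "m\<^sup>2 * inverse (w\<^sup>2 * x) = (m / (w * x))\<^sup>2 * x"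
    using pos w by (simp add: field_simps power2_eq_square)
  ultimately have "comparable (s / y) ((m / (w * x))\<^sup>2 * x)"
    by (metis comparable_sym comparable_trans)
  moreover have "0 < m / (w * x)"
    using pos w by simp
  ultimately show ?thesis
    unfolding same_square_class_def s_def by blast
qed

text \<open>Clearing denominators by a square keeps both sides of the form square times
  polynomial.\<close>

lemma same_square_class_to_fract:
  assumes "same_square_class y (to_fract f)" "same_square_class y (to_fract g)"
  shows "\<exists>p q. p \<noteq> 0 \<and> q \<noteq> 0 \<and> comparable (p\<^sup>2 * f) (q\<^sup>2 * g)"
proof -
  obtain v w where vw: "0 < v" "0 < w" "comparable y (v\<^sup>2 * to_fract f)"
      "comparable y (w\<^sup>2 * to_fract g)"
    using assms unfolding same_square_class_def by blast
  obtain p q where v: "v = Fract p q" "q \<noteq> 0" by (cases v)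
  obtain r s where w: "w = Fract r s" "s \<noteq> 0" by (cases w)
  have v': "v = to_fract p / to_fract q" and w': "w = to_fract r / to_fract s"
    using v w by (simp_all add: Fract_conv_to_fract)
  have nz: "p \<noteq> 0" "r \<noteq> 0"
    using vw v' w' by auto
  have "0 < (to_fract (q * s))\<^sup>2"
    using v w by simp
  then have "comparable ((to_fract (q * s))\<^sup>2 * (v\<^sup>2 * to_fract f))
      ((to_fract (q * s))\<^sup>2 * (w\<^sup>2 * to_fract g))"
    using comparable_trans[OF comparable_sym[OF vw(3)] vw(4)]
    by (rule comparable_mult[OF comparable_refl])
  moreover have "(to_fract (q * s))\<^sup>2 * (v\<^sup>2 * to_fract f) = to_fract ((p * s)\<^sup>2 * f)"
    using v(2) by (simp add: v' power_mult_distrib power_divide)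
  moreover have "(to_fract (q * s))\<^sup>2 * (w\<^sup>2 * to_fract g) = to_fract ((r * q)\<^sup>2 * g)"
    using w(2) by (simp add: w' power_mult_distrib power_divide)
  ultimately have "comparable ((p * s)\<^sup>2 * f) ((r * q)\<^sup>2 * g)"
    by (metis comparable_to_fractD)
  then show ?thesis
    using v w nz by (intro exI[of _ "p * s"] exI[of _ "r * q"]) simp
qed

text \<open>Squares have even degree, and leading coefficients are multiplicative. The second
  conclusion repeats the shape of the hypothesis one polynomial level lower, so the degree test can
  be iterated.\<close>

lemma comparable_square_mult_polyD:
  fixes p q f g :: "'a::linordered_idom poly"
  assumes "comparable (p\<^sup>2 * f) (q\<^sup>2 * g)" "p \<noteq> 0" "q \<noteq> 0"
  shows "even (degree f) \<longleftrightarrow> even (degree g)"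
    and "comparable ((lead_coeff p)\<^sup>2 * lead_coeff f) ((lead_coeff q)\<^sup>2 * lead_coeff g)"
proof -
  have "f \<noteq> 0" "g \<noteq> 0"
    using comparable_pos[OF assms(1)] by auto
  then have "2 * degree p + degree f = 2 * degree q + degree g"
    using comparable_poly(1)[OF assms(1)] assms by (simp add: degree_mult_eq degree_power_eq)
  then show "even (degree f) \<longleftrightarrow> even (degree g)"
    by (metis dvd_add_right_iff dvd_triv_left)
  show "comparable ((lead_coeff p)\<^sup>2 * lead_coeff f) ((lead_coeff q)\<^sup>2 * lead_coeff g)"
    using comparable_poly(2)[OF assms(1)] by (simp add: lead_coeff_mult lead_coeff_power)
qed

section \<open>Parity of cluster variables\<close>

lemma initial_variables_pos: "0 < x1" "0 < x2" "0 < x3"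
proof -
  have "to_fract 0 < x1" "to_fract 0 < x2" "to_fract 0 < x3"
    unfolding x1_def x2_def x3_def to_fract_less_iff
    by (simp_all add: less_poly_def pos_poly_def)
  then show "0 < x1" "0 < x2" "0 < x3"
    by simp_all
qed

lemma initial_variables_to_fract:
  obtains X1 X2 X3 where "x1 = to_fract X1" "x2 = to_fract X2" "x3 = to_fract X3"
  using x1_def x2_def x3_def by blast

text \<open>The parity of the degree in \<open>x3\<close> separates \<open>x3\<close> from the other
  two; after passing to leading coefficients, the degree in \<open>x2\<close> separates
  \<open>x2\<close> from \<open>x1\<close>.\<close>

lemma not_same_square_class:
  "\<not> (same_square_class y x1 \<and> same_square_class y x2)"
  "\<not> (same_square_class y x1 \<and> same_square_class y x3)"
  "\<not> (same_square_class y x2 \<and> same_square_class y x3)"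
proof -
  \<comment> \<open>The form \<open>[:g:]\<close> covers both \<open>x1\<close> and
    \<open>x2\<close>, which are constant in the outermost variable.\<close>
  have "\<not> (same_square_class y (to_fract [:g:]) \<and> same_square_class y x3)" for g
  proof
    assume "same_square_class y (to_fract [:g:]) \<and> same_square_class y x3"
    then obtain p q where "p \<noteq> 0" "q \<noteq> 0" "comparable (p\<^sup>2 * [:g:]) (q\<^sup>2 * [:0, 1:])"
      unfolding x3_def using same_square_class_to_fract by blast
    from comparable_square_mult_polyD(1)[OF this(3,1,2)] show False
      by simp
  qed
  then show "\<not> (same_square_class y x1 \<and> same_square_class y x3)"
    "\<not> (same_square_class y x2 \<and> same_square_class y x3)"
    unfolding x1_def x2_def by blast+
  show "\<not> (same_square_class y x1 \<and> same_square_class y x2)"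
  proof
    assume "same_square_class y x1 \<and> same_square_class y x2"
    then obtain p q :: "int poly poly poly" where pq: "p \<noteq> 0" "q \<noteq> 0"
        "comparable (p\<^sup>2 * [:[:[:0, 1:]:]:]) (q\<^sup>2 * [:[:0, 1:]:])"
      unfolding x1_def x2_def using same_square_class_to_fract by blast
    have "comparable ((lead_coeff p)\<^sup>2 * [:[:0, 1:]:]) ((lead_coeff q)\<^sup>2 * [:0, 1:])"
      using comparable_square_mult_polyD(2)[OF pq(3,1,2)] by simp
    from comparable_square_mult_polyD(1)[OF this] pq show False
      by simp
  qed
qed

text \<open>Induction over mutations; the positivity that the exchange step requires is part of the
  invariant, as every square class consists of positive elements.\<close>

lemma labeled_cluster_square_class:
  assumes "(a, b, c) \<in> labeled_clusters k"
  shows "same_square_class a x1" "same_square_class b x2" "same_square_class c x3"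
proof -
  obtain k1 k2 k3 where k: "k = (k1, k2, k3)" by (cases k)
  have "case t of (a, b, c) \<Rightarrow>
      same_square_class a x1 \<and> same_square_class b x2 \<and> same_square_class c x3"
    if "t \<in> labeled_clusters k" for t
    using that
    by induction
      (auto simp: k intro!: same_square_class_refl same_square_class_exchange
        initial_variables_pos dest: same_square_class_pos)
  then show "same_square_class a x1" "same_square_class b x2" "same_square_class c x3"
    using assms by auto
qed

lemma labeled_cluster_pos:
  assumes "(a, b, c) \<in> labeled_clusters k"
  shows "0 < a" "0 < b" "0 < c"
  using labeled_cluster_square_class[OF assms] same_square_class_pos by blast+

lemma labeled_cluster_entries_distinct:
  assumes "(a, b, c) \<in> labeled_clusters k" "(a', b', c') \<in> labeled_clusters k"
  shows "a \<noteq> b'" "a \<noteq> c'" "b \<noteq> c'"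
  using labeled_cluster_square_class[OF assms(1)] labeled_cluster_square_class[OF assms(2)]
    not_same_square_class by blast+

text \<open>The square class of a value determines its position, which resolves the definite
  description in \<open>parity\<close>.\<close>

lemma parity_entries:
  assumes "t \<in> labeled_clusters k" "i < 3"
  shows "parity k (entries t ! i) = entries k ! i"
proof -
  have "j = i" if "j < 3" "u \<in> labeled_clusters k" "entries u ! j = entries t ! i" for j u
  proof -
    obtain a b c a' b' c' where tu: "t = (a, b, c)" "u = (a', b', c')"
      by (cases t, cases u)
    have "i = 0 \<or> i = 1 \<or> i = 2" "j = 0 \<or> j = 1 \<or> j = 2"
      using assms(2) that(1) by auto
    then show ?thesis
      using that(3) labeled_cluster_entries_distinct[OF assms(1)[unfolded tu] that(2)[unfolded tu]]
        labeled_cluster_entries_distinct[OF that(2)[unfolded tu] assms(1)[unfolded tu]]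
      by (elim disjE) (simp_all add: tu)
  qed
  then have "(THE j. j < 3 \<and> (\<exists>u\<in>labeled_clusters k. entries u ! j = entries t ! i)) = i"
    using assms by (intro the_equality) auto
  then show ?thesis
    by (simp add: parity_def)
qed

lemma parity_labeled_cluster:
  assumes "(a, b, c) \<in> labeled_clusters (k1, k2, k3)"
  shows "parity (k1, k2, k3) a = k1" "parity (k1, k2, k3) b = k2" "parity (k1, k2, k3) c = k3"
  using parity_entries[OF assms, of 0] parity_entries[OF assms, of 1]
    parity_entries[OF assms, of 2] by simp_all

section \<open>Non-labeled clusters\<close>

text \<open>Vieta jumping: in each variable the equation is a monic quadratic, and mutation replaces
  one root by the other.\<close>

lemma labeled_cluster_markov:
  assumes "(a, b, c) \<in> labeled_clusters (k1, k2, k3)"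
  shows "a\<^sup>2 + b\<^sup>2 + c\<^sup>2 + of_nat k1 * b * c + of_nat k2 * a * c + of_nat k3 * a * b
           = markov_const (k1, k2, k3) * a * b * c"
proof -
  define M where "M = markov_const (k1, k2, k3)"
  \<comment> \<open>The roots of \<open>X^2 + r * X + s\<close> have product \<open>s\<close> and
    sum \<open>- r\<close>, so \<open>s / a\<close> is the second root.\<close>
  have exchange: "a'\<^sup>2 + r * a' + s = 0"
    if "a \<noteq> 0" "a' = s / a" "a\<^sup>2 + r * a + s = 0" for a a' r s :: ratfun
  proof -
    have "s = a * a'"
      using that by simp
    then have "a * (a + r + a') = 0"
      using that(3) by (simp add: power2_eq_square algebra_simps)
    then have a': "a' + r = - a"
      using that(1) by (metis add.assoc add.commute add_eq_0_iff mult_eq_0_iff)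
    have "a'\<^sup>2 + r * a' + s = a' * (a' + r) + s"
      by (simp add: power2_eq_square algebra_simps)
    then show ?thesis
      using \<open>s = a * a'\<close> by (simp add: a')
  qed
  have "case t of (a, b, c) \<Rightarrow>
      a\<^sup>2 + b\<^sup>2 + c\<^sup>2 + of_nat k1 * b * c + of_nat k2 * a * c + of_nat k3 * a * b = M * a * b * c"
    if "t \<in> labeled_clusters (k1, k2, k3)" for t
    using that
  proof induction
    case initial
    then show ?case
      using initial_variables_pos by (simp add: M_def)
  next
    case (mut1 t)
    obtain a b c where t: "t = (a, b, c)" by (cases t)
    have "a \<noteq> 0"
      using labeled_cluster_pos mut1.hyps t by fastforce
    define a' where "a' = (b\<^sup>2 + of_nat k1 * b * c + c\<^sup>2) / a"
    have "a'\<^sup>2 + (of_nat k2 * c + of_nat k3 * b - M * b * c) * a' + (b\<^sup>2 + of_nat k1 * b * c + c\<^sup>2) = 0"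
      by (rule exchange[OF \<open>a \<noteq> 0\<close> a'_def])
        (use mut1.IH in \<open>simp add: t algebra_simps\<close>)
    then show ?case
      unfolding t mutation1.simps prod.case a'_def[symmetric] by (simp add: algebra_simps)
  next
    case (mut2 t)
    obtain a b c where t: "t = (a, b, c)" by (cases t)
    have "b \<noteq> 0"
      using labeled_cluster_pos mut2.hyps t by fastforce
    define b' where "b' = (a\<^sup>2 + of_nat k2 * a * c + c\<^sup>2) / b"
    have "b'\<^sup>2 + (of_nat k1 * c + of_nat k3 * a - M * a * c) * b' + (a\<^sup>2 + of_nat k2 * a * c + c\<^sup>2) = 0"
      by (rule exchange[OF \<open>b \<noteq> 0\<close> b'_def])
        (use mut2.IH in \<open>simp add: t algebra_simps\<close>)
    then show ?case
      unfolding t mutation2.simps prod.case b'_def[symmetric] by (simp add: algebra_simps)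
  next
    case (mut3 t)
    obtain a b c where t: "t = (a, b, c)" by (cases t)
    have "c \<noteq> 0"
      using labeled_cluster_pos mut3.hyps t by fastforce
    define c' where "c' = (a\<^sup>2 + of_nat k3 * a * b + b\<^sup>2) / c"
    have "c'\<^sup>2 + (of_nat k1 * b + of_nat k2 * a - M * a * b) * c' + (a\<^sup>2 + of_nat k3 * a * b + b\<^sup>2) = 0"
      by (rule exchange[OF \<open>c \<noteq> 0\<close> c'_def])
        (use mut3.IH in \<open>simp add: t algebra_simps\<close>)
    then show ?case
      unfolding t mutation3.simps prod.case c'_def[symmetric] by (simp add: algebra_simps)
  qed
  then show ?thesis
    using assms by (auto simp: M_def)
qed

lemma nonlabeled_clusterE:
  assumes "(a, b, c) \<in> nonlabeled_clusters k"
  obtains u v w where "(u, v, w) \<in> labeled_clusters k"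
    "(a, b, c) \<in> {(u, v, w), (u, w, v), (v, u, w), (v, w, u), (w, u, v), (w, v, u)}"
proof -
  obtain u v w where u: "(u, v, w) \<in> labeled_clusters k" "{#a, b, c#} = {#u, v, w#}"
    using assms by (auto simp: nonlabeled_clusters_def)
  then have "a = u \<and> {#b, c#} = {#v, w#} \<or> a = v \<and> {#b, c#} = {#u, w#} \<or> a = w \<and> {#b, c#} = {#u, v#}"
    by (auto simp: add_eq_conv_ex)
  then show thesis
    by (intro that[OF u(1)]) (auto simp: add_eq_conv_ex)
qed

lemma nonlabeled_cluster_swap:
  assumes "(a, b, c) \<in> nonlabeled_clusters k"
  shows "(c, b, a) \<in> nonlabeled_clusters k" "(a, c, b) \<in> nonlabeled_clusters k"
  using assms by (auto simp: nonlabeled_clusters_def add_mset_commute)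

lemma nonlabeled_cluster_pos:
  assumes "(a, b, c) \<in> nonlabeled_clusters k"
  shows "0 < a" "0 < b" "0 < c"
  using assms by (auto elim!: nonlabeled_clusterE dest: labeled_cluster_pos)

text \<open>The equation is invariant under permuting entries together with their parities, so
  parities attached to values make it independent of the labeling.\<close>

lemma nonlabeled_cluster_markov:
  assumes "(a, b, c) \<in> nonlabeled_clusters k"
  shows "a\<^sup>2 + b\<^sup>2 + c\<^sup>2 + of_nat (parity k a) * b * c + of_nat (parity k b) * a * c
           + of_nat (parity k c) * a * b = markov_const k * a * b * c"
proof -
  obtain k1 k2 k3 where k: "k = (k1, k2, k3)" by (cases k)
  from assms obtain u v w where u: "(u, v, w) \<in> labeled_clusters k"
    "(a, b, c) \<in> {(u, v, w), (u, w, v), (v, u, w), (v, w, u), (w, u, v), (w, v, u)}"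
    by (rule nonlabeled_clusterE)
  show ?thesis
    using u(2) labeled_cluster_markov[OF u(1)[unfolded k]]
    by (auto simp: k parity_labeled_cluster[OF u(1)[unfolded k]] algebra_simps)
qed

text \<open>The new value takes the position of \<open>c\<close> in the underlying labeled cluster
  and hence inherits its parity. Mutation at other places reduces to this one by
  \<open>nonlabeled_cluster_swap\<close>.\<close>

lemma nonlabeled_cluster_mutation:
  assumes "(a, b, c) \<in> nonlabeled_clusters k"
    and "c' = (a\<^sup>2 + of_nat (parity k c) * a * b + b\<^sup>2) / c"
  shows "(a, b, c') \<in> nonlabeled_clusters k"
    "parity k c' = parity k c" "c' \<in> cluster_variables k"
proof -
  obtain k1 k2 k3 where k: "k = (k1, k2, k3)" by (cases k)
  from assms(1) obtain u v w where u: "(u, v, w) \<in> labeled_clusters k"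
    "(a, b, c) \<in> {(u, v, w), (u, w, v), (v, u, w), (v, w, u), (w, u, v), (w, v, u)}"
    by (rule nonlabeled_clusterE)
  note par = parity_labeled_cluster[OF u(1)[unfolded k]]
  have mut: "((v\<^sup>2 + of_nat k1 * v * w + w\<^sup>2) / u, v, w) \<in> labeled_clusters k"
    "(u, (u\<^sup>2 + of_nat k2 * u * w + w\<^sup>2) / v, w) \<in> labeled_clusters k"
    "(u, v, (u\<^sup>2 + of_nat k3 * u * v + v\<^sup>2) / w) \<in> labeled_clusters k"
    using labeled_clusters.mut1[OF u(1)] labeled_clusters.mut2[OF u(1)]
      labeled_clusters.mut3[OF u(1)] by (simp_all add: k)
  \<comment> \<open>Only the position of \<open>c\<close> matters: the exchange numerator is
    symmetric in \<open>a\<close> and \<open>b\<close>, so six permutations collapse to three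
    cases.\<close>
  have cases: "c = u \<and> (c', v, w) \<in> labeled_clusters k \<and> {#a, b#} = {#v, w#}
    \<or> c = v \<and> (u, c', w) \<in> labeled_clusters k \<and> {#a, b#} = {#u, w#}
    \<or> c = w \<and> (u, v, c') \<in> labeled_clusters k \<and> {#a, b#} = {#u, v#}"
    using u(2) mut par assms(2) by (auto simp: k ac_simps)
  have "(a, b, c') \<in> nonlabeled_clusters k"
    if "t \<in> labeled_clusters k" "{#a, b#} = X" "mset (entries t) = add_mset c' X" for t X
  proof -
    have "mset (entries (a, b, c')) = add_mset c' {#a, b#}"
      by simp
    with that show ?thesis
      unfolding nonlabeled_clusters_def mem_Collect_eq by metis
  qed
  from cases this[of "(c', v, w)"] this[of "(u, c', w)"] this[of "(u, v, c')"]
  show "(a, b, c') \<in> nonlabeled_clusters k"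
    by (elim disjE conjE) simp_all
  show "parity k c' = parity k c"
    using cases par by (auto simp: k dest: parity_labeled_cluster)
  show "c' \<in> cluster_variables k"
    using cases unfolding cluster_variables_def by fastforce
qed

section \<open>Laurent polynomials\<close>

lemma to_fract_in_laurent_ring: "to_fract p \<in> laurent_ring"
  unfolding laurent_ring_def
  by (rule CollectI, rule exI[of _ p], rule exI[of _ 0], rule exI[of _ 0], rule exI[of _ 0]) simp

lemma laurent_ring_uminus:
  assumes "y \<in> laurent_ring"
  shows "- y \<in> laurent_ring"
proof -
  obtain p i j l where "y = to_fract p / (x1 ^ i * x2 ^ j * x3 ^ l)"
    using assms unfolding laurent_ring_def by blast
  then have "- y = to_fract (- p) / (x1 ^ i * x2 ^ j * x3 ^ l)"
    by simp
  then show ?thesis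
    unfolding laurent_ring_def by blast
qed

lemma laurent_ring_mult:
  assumes "y \<in> laurent_ring" "z \<in> laurent_ring"
  shows "y * z \<in> laurent_ring"
proof -
  obtain p i j l q i' j' l' where "y = to_fract p / (x1 ^ i * x2 ^ j * x3 ^ l)"
      "z = to_fract q / (x1 ^ i' * x2 ^ j' * x3 ^ l')"
    using assms unfolding laurent_ring_def by blast
  then have "y * z = to_fract (p * q) / (x1 ^ (i + i') * x2 ^ (j + j') * x3 ^ (l + l'))"
    by (simp add: power_add mult_ac)
  then show ?thesis
    unfolding laurent_ring_def by blast
qed

lemma laurent_ring_add:
  assumes "y \<in> laurent_ring" "z \<in> laurent_ring"
  shows "y + z \<in> laurent_ring"
proof -
  obtain p i j l q i' j' l' where yz: "y = to_fract p / (x1 ^ i * x2 ^ j * x3 ^ l)"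
      "z = to_fract q / (x1 ^ i' * x2 ^ j' * x3 ^ l')"
    using assms unfolding laurent_ring_def by blast
  obtain X1 X2 X3 where X: "x1 = to_fract X1" "x2 = to_fract X2" "x3 = to_fract X3"
    by (rule initial_variables_to_fract)
  \<comment> \<open>With the monomial denominators as images of polynomials, the cross-multiplied
    numerator is visibly a polynomial.\<close>
  define d d' where "d = X1 ^ i * X2 ^ j * X3 ^ l" and "d' = X1 ^ i' * X2 ^ j' * X3 ^ l'"
  then have d: "x1 ^ i * x2 ^ j * x3 ^ l = to_fract d" "x1 ^ i' * x2 ^ j' * x3 ^ l' = to_fract d'"
    by (simp_all add: X)
  have nz: "to_fract d \<noteq> 0" "to_fract d' \<noteq> 0"
    using initial_variables_pos by (simp_all flip: d)
  have "y + z = to_fract (p * d' + q * d) / (to_fract d * to_fract d')"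
    using yz d nz by (simp add: add_frac_eq)
  also have "to_fract d * to_fract d' = x1 ^ (i + i') * x2 ^ (j + j') * x3 ^ (l + l')"
    by (simp add: power_add mult_ac flip: d)
  finally show ?thesis
    unfolding laurent_ring_def by blast
qed

lemma laurent_ring_diff:
  "y \<in> laurent_ring \<Longrightarrow> z \<in> laurent_ring \<Longrightarrow> y - z \<in> laurent_ring"
  using laurent_ring_add[of y "- z"] laurent_ring_uminus[of z] by simp

lemma of_nat_in_laurent_ring: "of_nat n \<in> laurent_ring"
  using to_fract_in_laurent_ring[of "of_nat n"] by simp

lemma markov_const_in_laurent_ring: "markov_const k \<in> laurent_ring"
proof -
  obtain k1 k2 k3 where k: "k = (k1, k2, k3)" by (cases k)
  obtain X1 X2 X3 where X: "x1 = to_fract X1" "x2 = to_fract X2" "x3 = to_fract X3"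
    by (rule initial_variables_to_fract)
  define p where "p = X1\<^sup>2 + X2\<^sup>2 + X3\<^sup>2 + of_nat k1 * X2 * X3 + of_nat k2 * X1 * X3
      + of_nat k3 * X1 * X2"
  then have "markov_const k = to_fract p / (x1 ^ 1 * x2 ^ 1 * x3 ^ 1)"
    by (simp add: k X)
  then show ?thesis
    unfolding laurent_ring_def by blast
qed

section \<open>Cluster generalized Cohn matrices\<close>

text \<open>Stated for bare field elements so that it serves both \<open>(P, Q, R)\<close> and the
  mirrored triple \<open>(R, Q, P)\<close>. The assumptions \<open>prod\<close> are the first row of
  \<open>P ** R - S_mat k Q\<close>; the conclusions concern the (1,2)-entry and the trace of
  \<open>P ** Q\<close>.\<close>

lemma cgc_product_entries:
  fixes a b c M ka kb kc p11 p21 p22 q11 q21 q22 r11 r21 r22 :: "'a::field"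
  assumes det: "p11 * p22 - a * p21 = 1" "q11 * q22 - b * q21 = 1" "r11 * r22 - c * r21 = 1"
    and tr: "p11 + p22 = M * a - ka" "q11 + q22 = M * b - kb" "r11 + r22 = M * c - kc"
    and prod: "q11 = p11 * r11 + a * r21 - kb" "b = p11 * c + a * r22"
    and markov: "a\<^sup>2 + b\<^sup>2 + c\<^sup>2 + ka * b * c + kb * a * c + kc * a * b = M * a * b * c"
    and nz: "a \<noteq> 0" "b \<noteq> 0" "c \<noteq> 0"
  shows "c * (p11 * b + a * q22) = a\<^sup>2 + kc * a * b + b\<^sup>2"
    and "p11 * q11 + a * q21 + p21 * b + p22 * q22 = M * (p11 * b + a * q22) + kc"
proof -
  have p11: "c * p11 = b - a * r22"
    using prod(2) by (simp add: mult.commute)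
  \<comment> \<open>The two brackets on the right are \<open>b\<close> and the determinant of
    \<open>R\<close>.\<close>
  have "c * (q11 + kb) = r11 * (p11 * c + a * r22) - a * (r11 * r22 - c * r21)"
    unfolding prod(1) by (simp add: algebra_simps)
  then have q11: "c * q11 = b * r11 - a - kb * c"
    using prod(2) det(3) by (simp add: algebra_simps)
  have p22: "p22 = M * a - ka - p11" and q22: "q22 = M * b - kb - q11"
    and r22: "r22 = M * c - kc - r11"
    using tr by (simp_all add: algebra_simps eq_diff_eq)
  have "c * (p11 * b + a * q22) = b * (c * p11) + a * (M * b * c - kb * c - c * q11)"
    by (simp add: q22 algebra_simps)
  then show m12: "c * (p11 * b + a * q22) = a\<^sup>2 + kc * a * b + b\<^sup>2"
    unfolding p11 q11 r22 by (simp add: power2_eq_square algebra_simps)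
  \<comment> \<open>The companion of the (1,2)-entry \<open>p11 * b + a * q22\<close>, with the
    diagonal entries of each matrix exchanged; here the Markov equation enters.\<close>
  have "c * (a * q11 + b * p22) = a * (c * q11) + b * (M * a * c - ka * c - c * p11)"
    by (simp add: p22 algebra_simps)
  also have "\<dots> = M * a * b * c + (M * a * b * c - (a\<^sup>2 + b\<^sup>2 + ka * b * c + kb * a * c + kc * a * b))"
    unfolding p11 q11 r22 by (simp add: power2_eq_square algebra_simps)
  also have "\<dots> = c * (c + M * a * b)"
    using markov by (simp add: power2_eq_square algebra_simps)
  finally have sum: "a * q11 + b * p22 = c + M * a * b"
    using nz(3) by simp
  \<comment> \<open>After scaling by \<open>a * b\<close>, the trace is the product of the
    (1,2)-entry and its companion, up to multiples of the determinants of \<open>P\<close> and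
    \<open>Q\<close>.\<close>
  have "a * b * (p11 * q11 + a * q21 + p21 * b + p22 * q22)
      = a * b * (p11 * q11 + p22 * q22) + a\<^sup>2 * (b * q21) + b\<^sup>2 * (a * p21)"
    by (simp add: power2_eq_square algebra_simps)
  also have "\<dots> = (a * q11 + b * p22) * (p11 * b + a * q22)
      - a\<^sup>2 * (q11 * q22 - b * q21) - b\<^sup>2 * (p11 * p22 - a * p21)"
    by (simp add: power2_eq_square algebra_simps)
  also have "\<dots> = c * (p11 * b + a * q22) + M * a * b * (p11 * b + a * q22) - a\<^sup>2 - b\<^sup>2"
    unfolding sum det by (simp add: algebra_simps)
  also have "\<dots> = a * b * (M * (p11 * b + a * q22) + kc)"
    unfolding m12 by (simp add: algebra_simps)
  finally show "p11 * q11 + a * q21 + p21 * b + p22 * q22 = M * (p11 * b + a * q22) + kc"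
    using nz by simp
qed

section \<open>Matrices in SL2 and subtraction of the S-matrix\<close>

lemma S_mat_nth:
  "S_mat k P $ 1 $ 1 = markov_const k * P $ 1 $ 2 - trace P"
  "S_mat k P $ 1 $ 2 = 0"
  "S_mat k P $ 2 $ 1 = (markov_const k * P $ 1 $ 2 - trace P) * markov_const k"
  "S_mat k P $ 2 $ 2 = markov_const k * P $ 1 $ 2 - trace P"
  by (simp_all add: S_mat_def Let_def)

lemma trace_2: "trace (A :: 'a::comm_ring_1 ^ 2 ^ 2) = A $ 1 $ 1 + A $ 2 $ 2"
  by (simp add: trace_def sum_2)

lemma matrix_mult_2:
  fixes A B :: "'a::comm_ring_1 ^ 2 ^ 2"
  shows "(A ** B) $ i $ j = A $ i $ 1 * B $ 1 $ j + A $ i $ 2 * B $ 2 $ j"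
  by (simp add: matrix_matrix_mult_def sum_2)

lemma SL2_laurent_mult:
  assumes "A \<in> SL2_laurent" "B \<in> SL2_laurent"
  shows "A ** B \<in> SL2_laurent"
  using assms
  by (auto simp: SL2_laurent_def det_mul matrix_mult_2 intro!: laurent_ring_add laurent_ring_mult)

text \<open>By \<open>trR\<close>, \<open>S_mat k R\<close> is \<open>n\<close> times
  \<open>[1, 0; M, 1]\<close>; subtracting it turns the trace offset \<open>+ n\<close> into
  \<open>- n\<close>. Since \<open>S_mat\<close> depends only on this offset, the new matrix has the
  same S-matrix as \<open>R\<close>, as the triple condition on a middle matrix demands.\<close>

lemma SL2_laurent_minus_S_mat:
  fixes n :: nat
  assumes X: "X \<in> SL2_laurent" and trX: "trace X = markov_const k * X $ 1 $ 2 + of_nat n"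
    and trR: "trace R = markov_const k * R $ 1 $ 2 - of_nat n"
  shows "(X - S_mat k R) $ 1 $ 2 = X $ 1 $ 2"
    and "trace (X - S_mat k R) = markov_const k * X $ 1 $ 2 - of_nat n"
    and "X - S_mat k R \<in> SL2_laurent"
    and "S_mat k (X - S_mat k R) = S_mat k R"
proof -
  define M where "M = markov_const k"
  define N where "N = X - S_mat k R"
  have N: "N $ 1 $ 1 = X $ 1 $ 1 - of_nat n" "N $ 1 $ 2 = X $ 1 $ 2"
    "N $ 2 $ 1 = X $ 2 $ 1 - of_nat n * M" "N $ 2 $ 2 = X $ 2 $ 2 - of_nat n"
    by (simp_all add: N_def S_mat_nth trR M_def)
  have tr: "trace N = M * X $ 1 $ 2 - of_nat n"
    using trX by (simp add: trace_2 N M_def)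
  \<comment> \<open>The bracket vanishes by \<open>trX\<close>, so the determinant is
    unchanged.\<close>
  have "det N = det X - of_nat n * (trace X - M * X $ 1 $ 2 - of_nat n)"
    by (simp add: det_2 N trace_2 algebra_simps)
  then have "det N = 1"
    using X by (simp add: trX M_def SL2_laurent_def)
  moreover have "N $ i $ j \<in> laurent_ring" for i j
    using X N exhaust_2[of i] exhaust_2[of j]
    by (auto simp: SL2_laurent_def M_def intro!: laurent_ring_diff laurent_ring_mult
        of_nat_in_laurent_ring markov_const_in_laurent_ring)
  ultimately have "N \<in> SL2_laurent"
    by (simp add: SL2_laurent_def)
  moreover have "S_mat k N = S_mat k R"
    using tr by (simp add: S_mat_def N trR M_def)
  ultimately show "(X - S_mat k R) $ 1 $ 2 = X $ 1 $ 2"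
    "trace (X - S_mat k R) = markov_const k * X $ 1 $ 2 - of_nat n"
    "X - S_mat k R \<in> SL2_laurent" "S_mat k (X - S_mat k R) = S_mat k R"
    using N tr by (simp_all add: N_def M_def)
qed

theorem theorem4p6:
  fixes k1 k2 k3 :: nat
    and P Q R :: "ratfun ^ 2 ^ 2"
    and a b c :: ratfun
  assumes "cgc_triple (k1, k2, k3) (P, Q, R)"
    and "associated_cluster (P, Q, R) = (a, b, c)"
  shows "(P ** Q - S_mat (k1, k2, k3) R) $ 1 $ 2
           = (a\<^sup>2 + of_nat (parity (k1, k2, k3) c) * a * b + b\<^sup>2) / c
       \<and> (Q ** R - S_mat (k1, k2, k3) P) $ 1 $ 2
           = (b\<^sup>2 + of_nat (parity (k1, k2, k3) a) * b * c + c\<^sup>2) / a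
       \<and> trace (P ** Q - S_mat (k1, k2, k3) R)
           = markov_const (k1, k2, k3) * (P ** Q - S_mat (k1, k2, k3) R) $ 1 $ 2
             - of_nat (parity (k1, k2, k3) c)
       \<and> trace (Q ** R - S_mat (k1, k2, k3) P)
           = markov_const (k1, k2, k3) * (Q ** R - S_mat (k1, k2, k3) P) $ 1 $ 2
             - of_nat (parity (k1, k2, k3) a)
       \<and> P ** Q - S_mat (k1, k2, k3) R \<in> SL2_laurent
       \<and> Q ** R - S_mat (k1, k2, k3) P \<in> SL2_laurent
       \<and> cgc_triple (k1, k2, k3) (P, P ** Q - S_mat (k1, k2, k3) R, Q)
       \<and> cgc_triple (k1, k2, k3) (Q, Q ** R - S_mat (k1, k2, k3) P, R)"
proof -
  define k where "k = (k1, k2, k3)"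
  define M where "M = markov_const k"
  define ka kb kc :: ratfun where "ka = of_nat (parity k a)" and "kb = of_nat (parity k b)"
    and "kc = of_nat (parity k c)"
  have entry: "P $ 1 $ 2 = a" "Q $ 1 $ 2 = b" "R $ 1 $ 2 = c"
    using assms(2) by simp_all
  have cgc: "cgc_matrix k P" "cgc_matrix k Q" "cgc_matrix k R"
    and prod: "Q = P ** R - S_mat k Q" and cluster: "(a, b, c) \<in> nonlabeled_clusters k"
    using assms(1) entry by (simp_all add: k_def)
  have SL2: "P \<in> SL2_laurent" "Q \<in> SL2_laurent" "R \<in> SL2_laurent"
    and tr: "trace P = M * a - ka" "trace Q = M * b - kb" "trace R = M * c - kc"
    using cgc by (simp_all add: cgc_matrix_def entry M_def ka_def kb_def kc_def)
  have det: "P $ 1 $ 1 * P $ 2 $ 2 - a * P $ 2 $ 1 = 1"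
    "Q $ 1 $ 1 * Q $ 2 $ 2 - b * Q $ 2 $ 1 = 1" "R $ 1 $ 1 * R $ 2 $ 2 - c * R $ 2 $ 1 = 1"
    using SL2 by (simp_all add: SL2_laurent_def det_2 entry)
  have S: "S_mat k Q $ 1 $ 1 = kb" "S_mat k Q $ 1 $ 2 = 0" "S_mat k Q $ 2 $ 2 = kb"
    using tr(2) by (simp_all add: S_mat_nth entry M_def)
  have q: "Q $ 1 $ 1 = P $ 1 $ 1 * R $ 1 $ 1 + a * R $ 2 $ 1 - kb"
    "b = P $ 1 $ 1 * c + a * R $ 2 $ 2"
    "Q $ 2 $ 2 = P $ 2 $ 1 * c + P $ 2 $ 2 * R $ 2 $ 2 - kb"
    using arg_cong[OF prod, of "\<lambda>A. A $ 1 $ 1"] arg_cong[OF prod, of "\<lambda>A. A $ 1 $ 2"]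
      arg_cong[OF prod, of "\<lambda>A. A $ 2 $ 2"] by (simp_all add: S matrix_mult_2 entry)
  have nz: "a \<noteq> 0" "b \<noteq> 0" "c \<noteq> 0"
    using nonlabeled_cluster_pos[OF cluster] by auto
  have markov: "a\<^sup>2 + b\<^sup>2 + c\<^sup>2 + ka * b * c + kb * a * c + kc * a * b = M * a * b * c"
    using nonlabeled_cluster_markov[OF cluster] by (simp add: ka_def kb_def kc_def M_def)
  have trPQ: "trace (P ** Q) = M * (P ** Q) $ 1 $ 2 + kc"
    and PQ: "(P ** Q) $ 1 $ 2 = (a\<^sup>2 + kc * a * b + b\<^sup>2) / c"
    using cgc_product_entries[OF det tr[unfolded trace_2] q(1,2) markov nz] nz
    by (simp_all add: trace_2 matrix_mult_2 entry field_simps)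
  \<comment> \<open>The hypotheses for \<open>(R, Q, P)\<close> with exchanged diagonal entries.\<close>
  have det': "R $ 2 $ 2 * R $ 1 $ 1 - c * R $ 2 $ 1 = 1"
    "Q $ 2 $ 2 * Q $ 1 $ 1 - b * Q $ 2 $ 1 = 1" "P $ 2 $ 2 * P $ 1 $ 1 - a * P $ 2 $ 1 = 1"
    using det by (simp_all only: mult.commute)
  have tr': "R $ 2 $ 2 + R $ 1 $ 1 = M * c - kc" "Q $ 2 $ 2 + Q $ 1 $ 1 = M * b - kb"
    "P $ 2 $ 2 + P $ 1 $ 1 = M * a - ka"
    using tr by (simp_all only: trace_2 add.commute)
  have q': "Q $ 2 $ 2 = R $ 2 $ 2 * P $ 2 $ 2 + c * P $ 2 $ 1 - kb"
    "b = R $ 2 $ 2 * a + c * P $ 1 $ 1"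
    using q(2,3) by (simp_all only: ac_simps)
  have markov': "c\<^sup>2 + b\<^sup>2 + a\<^sup>2 + kc * b * a + kb * c * a + ka * c * b = M * c * b * a"
    using markov by (simp add: ac_simps)
  \<comment> \<open>Under the mirroring, \<open>p11 * b + a * q22\<close> becomes
    \<open>R $ 2 $ 2 * b + c * Q $ 1 $ 1\<close>, the (1,2)-entry of \<open>Q ** R\<close>.\<close>
  note QR_entries = cgc_product_entries[OF det' tr' q' markov' nz(3,2,1)]
  have trQR: "trace (Q ** R) = M * (Q ** R) $ 1 $ 2 + ka"
    and QR: "(Q ** R) $ 1 $ 2 = (b\<^sup>2 + ka * b * c + c\<^sup>2) / a"
    using QR_entries nz by (simp_all add: trace_2 matrix_mult_2 entry field_simps)
  have "trace R = markov_const k * R $ 1 $ 2 - of_nat (parity k c)"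
    "trace P = markov_const k * P $ 1 $ 2 - of_nat (parity k a)"
    using tr by (simp_all add: entry M_def ka_def kc_def)
  note m = SL2_laurent_minus_S_mat[OF SL2_laurent_mult[OF SL2(1,2)] trPQ[unfolded M_def kc_def] this(1)]
    and n = SL2_laurent_minus_S_mat[OF SL2_laurent_mult[OF SL2(2,3)] trQR[unfolded M_def ka_def] this(2)]
  note m_mut = nonlabeled_cluster_mutation[OF cluster PQ[unfolded kc_def]]
  \<comment> \<open>The order is reversed so that the entry to be mutated stands last.\<close>
  have "(c, b, a) \<in> nonlabeled_clusters k" "(Q ** R) $ 1 $ 2 = (c\<^sup>2 + of_nat (parity k a) * c * b + b\<^sup>2) / a"
    using nonlabeled_cluster_swap(1)[OF cluster] QR by (simp_all add: ka_def algebra_simps)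
  note n_mut = nonlabeled_cluster_mutation[OF this]
  have "cgc_triple k (P, P ** Q - S_mat k R, Q)"
    using cgc m m_mut nonlabeled_cluster_swap(2)[OF m_mut(1)]
    by (simp add: cgc_matrix_def entry)
  \<comment> \<open>With \<open>a'\<close> the mutated entry, the swaps lead from
    \<open>(c, b, a')\<close> over \<open>(c, a', b)\<close> to \<open>(b, a', c)\<close>.\<close>
  moreover have "cgc_triple k (Q, Q ** R - S_mat k P, R)"
    using cgc n n_mut nonlabeled_cluster_swap(1)[OF nonlabeled_cluster_swap(2)[OF n_mut(1)]]
    by (simp add: cgc_matrix_def entry)
  ultimately show ?thesis
    using m n PQ QR by (simp add: ka_def kc_def k_def)
qed

end
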